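(* Let $\mathbb{K}\in\{\mathbb{R},\mathbb{C}\}$. There are almost singular projective transformations $M\in\mathrm{GL}_3(\mathbb{K}^* )$ of $\mathbb{K}^*\mathbb{P}^2$ which do not preserve the properties of being almost equivalent and of being almost collinear; that is, there are points that are almost equivalent whose images under $M$ are not almost equivalent, and there are three points that are almost collinear whose images under $M$ are not almost collinear.
   Context: $\mathbb{R}^*$ and $\mathbb{C}^*$ are the hyperreal and hypercomplex numbers of non-standard analysis ($\mathbb{C}^*=\mathbb{R}^*+i\,\mathbb{R}^*$). $\mathbb{I}$ is the set of infinitesimal numbers. A number $r$ is appreciable if $1/n<|r|<n$ for some $n\in\mathbb{N}$; $\mathbb{A}$ is the set of appreciable numbers. $a\simeq b$ means $a-b$ is infinitesimal (componentwise for vectors). Points and lines of $\mathbb{K}^*\mathbb{P}^2$ are both given by elements of $((\mathbb{K}^* )^3\setminus\{0\})/(\mathbb{K}^*\setminus\{0\})$. $\|\cdot\|$ is the Euclidean norm on vectors and the Frobenius norm on matrices. For nonzero $r$, $\mathbf{mag}(r)=\{s\neq 0 : \exists A\in\mathbb{A},\ r=A s\}$. An appreciable representative of a point or line $x$ is $x_{\mathbb{A}}=\lambda^{-1}x$ with $\lambda\in\mathbf{mag}(\|x\|)$. An appreciable representative of a nonzero matrix $M$ is $M_{\mathbb{A}}=\lambda^{-1}M$ with $\lambda\in\mathbf{mag}(\|M\|)$. $M$ is almost singular if $\det(M_{\mathbb{A}})\in\mathbb{I}\setminus\{0\}$. The projective transformation given by $M$ sends a point $p$ to $M_{\mathbb{A}}p_{\mathbb{A}}$.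 Two points $x,y$ are almost equivalent if there is $\lambda\in\mathbb{K}^*$ with $x_{\mathbb{A}}\simeq\lambda\,y_{\mathbb{A}}$. For points $y,z$, $\mathbf{join}_*(y,z)=y_{\mathbb{A}}\times z_{\mathbb{A}}$ (cross product). Three points $x,y,z$ are almost collinear if, with $l:=\mathbf{join}_*(y,z)$, $\langle x_{\mathbb{A}},l_{\mathbb{A}}\rangle\in\mathbb{I}$, where $\langle u,v\rangle=\overline{u}^Tv$ and $l_{\mathbb{A}}$ is an appreciable representative of $l$. *)

theory Defs
  imports "HOL-Analysis.Analysis" "Jordan_Normal_Form.Conjugate"
begin

section \<open>Hyperreal and hypercomplex numbers as ultrapowers\<close>

definition free_ultrafilter :: "nat filter \<Rightarrow> bool" where
  "free_ultrafilter U \<longleftrightarrow> U \<noteq> bot \<and> U \<le> cofinite \<and>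
     (\<forall>P. eventually P U \<or> eventually (\<lambda>n. \<not> P n) U)"

lemma free_ultrafilter_exists: "\<exists>U. free_ultrafilter U"
proof -
  define A :: "nat filter set" where "A = {F. F \<noteq> bot \<and> F \<le> cofinite}"
  have "\<exists>m\<in>A. \<forall>a\<in>A. a \<le> m \<longrightarrow> a = m"
  proof (rule predicate_Zorn)
    show "partial_order_on A (relation_of (\<lambda>x y. y \<le> x) A)"
      by (rule partial_order_on_relation_ofI) auto
  next
    fix C assume C: "C \<in> Chains (relation_of (\<lambda>x y. y \<le> x) A)"
    have sub: "C \<subseteq> A" and tot: "\<And>F G. F \<in> C \<Longrightarrow> G \<in> C \<Longrightarrow> F \<le> G \<or> G \<le> F"
      using C by (auto simp: Chains_def relation_of_def)
    show "\<exists>u\<in>A. \<forall>a\<in>C. u \<le> a"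
    proof (cases "C = {}")
      case True
      have "cofinite \<in> A" by (simp add: A_def)
      then show ?thesis using True by auto
    next
      case False
      have ev: "eventually P (Inf C) \<longleftrightarrow> (\<exists>F\<in>C. eventually P F)" for P
        by (rule eventually_Inf_base[OF False]) (use tot in \<open>metis inf.absorb1 inf.absorb2 order_refl\<close>)
      have "Inf C \<noteq> bot"
        using sub unfolding trivial_limit_def ev by (auto simp: A_def trivial_limit_def)
      moreover have "Inf C \<le> cofinite"
        using False sub by (auto simp: A_def intro: Inf_lower2)
      ultimately have "Inf C \<in> A" by (simp add: A_def)
      then show ?thesis by (auto intro: Inf_lower)
    qed
  qed
  then obtain U where "U \<in> A" and max: "\<forall>F\<in>A. F \<le> U \<longrightarrow> F = U" ..
  then have U: "U \<noteq> bot" "U \<le> cofinite" by (auto simp: A_def)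
  have min: "F = U" if "F \<noteq> bot" "F \<le> U" for F
    using max that order_trans[OF that(2) U(2)] by (simp add: A_def)
  have "eventually P U \<or> eventually (\<lambda>n. \<not> P n) U" for P
  proof (rule disjCI)
    assume "\<not> eventually (\<lambda>n. \<not> P n) U"
    then have "inf U (principal {n. P n}) \<noteq> bot"
      by (simp add: trivial_limit_def eventually_inf_principal)
    then have "inf U (principal {n. P n}) = U" by (rule min) simp
    then have "U \<le> principal {n. P n}" by (metis inf.cobounded2)
    then show "eventually P U" by (simp add: le_principal)
  qed
  then show ?thesis using U by (auto simp: free_ultrafilter_def)
qed

definition \<U> :: "nat filter" where
  "\<U> = (SOME U. free_ultrafilter U)"

lemma free_ultrafilter_U: "free_ultrafilter \<U>"
  unfolding \<U>_def by (rule someI_ex[OF free_ultrafilter_exists])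

lemma U_nontrivial: "\<U> \<noteq> bot"
  using free_ultrafilter_U by (simp add: free_ultrafilter_def)

lemma U_le_sequentially: "\<U> \<le> sequentially"
  using free_ultrafilter_U by (simp add: free_ultrafilter_def cofinite_eq_sequentially)

lemma eventually_U_not_iff: "eventually (\<lambda>n. \<not> P n) \<U> \<longleftrightarrow> \<not> eventually P \<U>"
proof
  assume "eventually (\<lambda>n. \<not> P n) \<U>"
  then show "\<not> eventually P \<U>"
    using U_nontrivial eventually_conj[of P \<U> "\<lambda>n. \<not> P n"] by (auto simp: trivial_limit_def)
next
  assume "\<not> eventually P \<U>"
  then show "eventually (\<lambda>n. \<not> P n) \<U>"
    using free_ultrafilter_U by (auto simp: free_ultrafilter_def)
qed

lemma eventually_U_disj_iff:
  "eventually (\<lambda>n. P n \<or> Q n) \<U> \<longleftrightarrow> eventually P \<U> \<or> eventually Q \<U>"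
  using eventually_U_not_iff[of "\<lambda>n. P n \<or> Q n"] eventually_U_not_iff[of P] eventually_U_not_iff[of Q]
  by (auto simp: eventually_conj_iff)

definition hyper_rel :: "(nat \<Rightarrow> 'a) \<Rightarrow> (nat \<Rightarrow> 'a) \<Rightarrow> bool" where
  "hyper_rel f g \<longleftrightarrow> eventually (\<lambda>n. f n = g n) \<U>"

text \<open>\<open>real hyper\<close> is the field of hyperreal numbers, \<open>complex hyper\<close> that of hypercomplex numbers.\<close>

quotient_type 'a hyper = "nat \<Rightarrow> 'a" / hyper_rel
  morphisms rep_class class_of
proof (rule equivpI)
  show "reflp (hyper_rel :: (nat \<Rightarrow> 'a) \<Rightarrow> _)" by (simp add: reflp_def hyper_rel_def)
  show "symp (hyper_rel :: (nat \<Rightarrow> 'a) \<Rightarrow> _)"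
    by (auto simp: symp_def hyper_rel_def elim: eventually_mono)
  show "transp (hyper_rel :: (nat \<Rightarrow> 'a) \<Rightarrow> _)"
    unfolding transp_def hyper_rel_def by (auto elim: eventually_elim2)
qed

lift_definition hyper_const :: "'a \<Rightarrow> 'a hyper" is "\<lambda>a n. a" .

lift_definition hyper_map :: "('a \<Rightarrow> 'b) \<Rightarrow> 'a hyper \<Rightarrow> 'b hyper" is "\<lambda>h f n. h (f n)"
  by (auto simp: hyper_rel_def elim: eventually_mono)

instantiation hyper :: (comm_ring_1) comm_ring_1
begin

lift_definition zero_hyper :: "'a hyper" is "\<lambda>n. 0" .
lift_definition one_hyper :: "'a hyper" is "\<lambda>n. 1" .
lift_definition plus_hyper :: "'a hyper \<Rightarrow> 'a hyper \<Rightarrow> 'a hyper" is "\<lambda>f g n. f n + g n"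
  unfolding hyper_rel_def by (auto elim: eventually_elim2)
lift_definition minus_hyper :: "'a hyper \<Rightarrow> 'a hyper \<Rightarrow> 'a hyper" is "\<lambda>f g n. f n - g n"
  unfolding hyper_rel_def by (auto elim: eventually_elim2)
lift_definition times_hyper :: "'a hyper \<Rightarrow> 'a hyper \<Rightarrow> 'a hyper" is "\<lambda>f g n. f n * g n"
  unfolding hyper_rel_def by (auto elim: eventually_elim2)
lift_definition uminus_hyper :: "'a hyper \<Rightarrow> 'a hyper" is "\<lambda>f n. - f n"
  unfolding hyper_rel_def by (auto elim: eventually_mono)

instance
proof
  show "(0 :: 'a hyper) \<noteq> 1"
    by transfer (simp add: hyper_rel_def U_nontrivial)
qed (transfer; simp add: hyper_rel_def algebra_simps)+

end

instantiation hyper :: (field) field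
begin

lift_definition inverse_hyper :: "'a hyper \<Rightarrow> 'a hyper" is "\<lambda>f n. inverse (f n)"
  unfolding hyper_rel_def by (auto elim: eventually_mono)
lift_definition divide_hyper :: "'a hyper \<Rightarrow> 'a hyper \<Rightarrow> 'a hyper" is "\<lambda>f g n. f n / g n"
  unfolding hyper_rel_def by (auto elim: eventually_elim2)

instance
proof
  fix a b :: "'a hyper"
  show "a \<noteq> 0 \<Longrightarrow> inverse a * a = 1"
    by transfer (auto simp: hyper_rel_def eventually_U_not_iff[symmetric] elim: eventually_mono)
  show "a div b = a * inverse b"
    by transfer (simp add: hyper_rel_def divide_inverse)
  show "inverse (0 :: 'a hyper) = 0"
    by transfer (simp add: hyper_rel_def)
qed

end

instantiation hyper :: (linordered_field) linordered_field
begin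

lift_definition less_eq_hyper :: "'a hyper \<Rightarrow> 'a hyper \<Rightarrow> bool"
  is "\<lambda>f g. eventually (\<lambda>n. f n \<le> g n) \<U>"
  unfolding hyper_rel_def by (rule iffI; elim eventually_rev_mp; auto elim: eventually_mono)
lift_definition less_hyper :: "'a hyper \<Rightarrow> 'a hyper \<Rightarrow> bool"
  is "\<lambda>f g. eventually (\<lambda>n. f n < g n) \<U>"
  unfolding hyper_rel_def by (rule iffI; elim eventually_rev_mp; auto elim: eventually_mono)
lift_definition abs_hyper :: "'a hyper \<Rightarrow> 'a hyper" is "\<lambda>f n. \<bar>f n\<bar>"
  unfolding hyper_rel_def by (auto elim: eventually_mono)
lift_definition sgn_hyper :: "'a hyper \<Rightarrow> 'a hyper" is "\<lambda>f n. sgn (f n)"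
  unfolding hyper_rel_def by (auto elim: eventually_mono)

instance
proof
  fix a b c :: "'a hyper"
  show "a < b \<longleftrightarrow> a \<le> b \<and> \<not> b \<le> a"
    by transfer (simp add: eventually_U_not_iff[symmetric] eventually_conj_iff[symmetric] less_le_not_le)
  show "a \<le> a" by transfer simp
  show "a \<le> b \<Longrightarrow> b \<le> c \<Longrightarrow> a \<le> c" by transfer (auto elim: eventually_elim2)
  show "a \<le> b \<Longrightarrow> b \<le> a \<Longrightarrow> a = b"
    by transfer (auto simp: hyper_rel_def elim: eventually_elim2)
  show "a \<le> b \<or> b \<le> a" by transfer (simp add: eventually_U_disj_iff[symmetric] linear)
  show "a \<le> b \<Longrightarrow> c + a \<le> c + b" by transfer simp
  show "a < b \<Longrightarrow> 0 < c \<Longrightarrow> c * a < c * b"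
    by transfer (auto elim: eventually_elim2)
  show "\<bar>a\<bar> = (if a < 0 then - a else a)"
  proof (cases "a < 0")
    case True
    then have "\<bar>a\<bar> = - a" by transfer (auto simp: hyper_rel_def elim: eventually_mono)
    with True show ?thesis by simp
  next
    case False
    then have "\<bar>a\<bar> = a"
      by transfer (auto simp: hyper_rel_def eventually_U_not_iff[symmetric] elim: eventually_mono)
    with False show ?thesis by simp
  qed
  show "sgn a = (if a = 0 then 0 else if 0 < a then 1 else - 1)"
  proof -
    consider "a = 0" | "a \<noteq> 0" "0 < a" | "a \<noteq> 0" "\<not> 0 < a" by blast
    then show ?thesis
    proof cases
      case 1
      then have "sgn a = 0" by transfer (auto simp: hyper_rel_def elim: eventually_mono)
      with 1 show ?thesis by simp
    next
      case 2
      then have "sgn a = 1" by transfer (auto simp: hyper_rel_def elim: eventually_mono)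
      with 2 show ?thesis by simp
    next
      case 3
      then have "sgn a = - 1"
        by transfer (auto simp: hyper_rel_def eventually_U_not_iff[symmetric] not_less elim: eventually_elim2)
      with 3 show ?thesis by simp
    qed
  qed
qed

end

lift_definition hsqrt :: "real hyper \<Rightarrow> real hyper" is "\<lambda>f n. sqrt (f n)"
  unfolding hyper_rel_def by (auto elim: eventually_mono)

text \<open>Absolute value with values in the hyperreals, uniformly for both ground fields.\<close>

lift_definition hnorm :: "'a::real_normed_field hyper \<Rightarrow> real hyper" is "\<lambda>f n. norm (f n)"
  unfolding hyper_rel_def by (auto elim: eventually_mono)

lift_definition of_hreal :: "real hyper \<Rightarrow> 'a::real_normed_field hyper" is "\<lambda>f n. of_real (f n)"
  unfolding hyper_rel_def by (auto elim: eventually_mono)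

lift_definition hconj :: "'a::conjugatable_field hyper \<Rightarrow> 'a hyper" is "\<lambda>f n. conjugate (f n)"
  unfolding hyper_rel_def by (auto elim: eventually_mono)

lemma hnorm_real: "hnorm x = \<bar>x\<bar>"
  by transfer (simp add: hyper_rel_def)

lemma hconj_real: "hconj (x :: real hyper) = x"
  by transfer (simp add: hyper_rel_def)

lemma of_hreal_real: "of_hreal x = x"
  by transfer (simp add: hyper_rel_def)

lemma hypercomplex_decomposition:
  "\<exists>!(a, b). (z :: complex hyper) = of_hreal a + hyper_const \<i> * of_hreal b"
proof -
  have "z = of_hreal (hyper_map Re z) + hyper_const \<i> * of_hreal (hyper_map Im z)"
    by transfer (simp add: hyper_rel_def complex_eq[symmetric])
  moreover have "a = c \<and> b = d"
    if "of_hreal a + hyper_const \<i> * of_hreal b = of_hreal c + hyper_const \<i> * of_hreal d" for a b c d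
    using that by transfer (auto simp: hyper_rel_def complex_eq_iff eventually_conj_iff)
  ultimately show ?thesis by (intro ex1I[of _ "(hyper_map Re z, hyper_map Im z)"]) auto
qed

section \<open>Infinitesimal and appreciable numbers\<close>

definition infinitesimal :: "'a::real_normed_field hyper \<Rightarrow> bool" where
  "infinitesimal r \<longleftrightarrow> (\<forall>n::nat. n > 0 \<longrightarrow> hnorm r < 1 / of_nat n)"

definition appreciable :: "'a::real_normed_field hyper \<Rightarrow> bool" where
  "appreciable r \<longleftrightarrow> (\<exists>n::nat. 1 / of_nat n < hnorm r \<and> hnorm r < of_nat n)"

definition mag :: "'a::real_normed_field hyper \<Rightarrow> 'a hyper set" where
  "mag r = {s. s \<noteq> 0 \<and> (\<exists>A. appreciable A \<and> r = A * s)}"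

definition inf_close :: "'a::real_normed_field hyper ^ 'n \<Rightarrow> 'a hyper ^ 'n \<Rightarrow> bool"
  (infix \<open>\<simeq>\<close> 50) where
  "u \<simeq> v \<longleftrightarrow> (\<forall>i. infinitesimal (u $ i - v $ i))"

section \<open>Vectors and matrices\<close>

definition hvec_norm :: "'a::real_normed_field hyper ^ 'n \<Rightarrow> real hyper" where
  "hvec_norm v = hsqrt (\<Sum>i\<in>UNIV. (hnorm (v $ i))\<^sup>2)"

definition frobenius_norm :: "'a::real_normed_field hyper ^ 'n ^ 'm \<Rightarrow> real hyper" where
  "frobenius_norm M = hsqrt (\<Sum>i\<in>UNIV. \<Sum>j\<in>UNIV. (hnorm (M $ i $ j))\<^sup>2)"

definition hinner :: "'a::conjugatable_field hyper ^ 'n \<Rightarrow> 'a hyper ^ 'n \<Rightarrow> 'a hyper" where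
  "hinner u v = (\<Sum>i\<in>UNIV. hconj (u $ i) * v $ i)"

text \<open>The library's cross product \<^const>\<open>cross3\<close> is restricted to real vectors.\<close>

definition cross :: "'a::comm_ring_1 ^ 3 \<Rightarrow> 'a ^ 3 \<Rightarrow> 'a ^ 3" where
  "cross u v = vector [u $ 2 * v $ 3 - u $ 3 * v $ 2,
                       u $ 3 * v $ 1 - u $ 1 * v $ 3,
                       u $ 1 * v $ 2 - u $ 2 * v $ 1]"

section \<open>The projective plane\<close>

definition proj_rel :: "'a::field ^ 3 \<Rightarrow> 'a ^ 3 \<Rightarrow> bool" where
  "proj_rel x y \<longleftrightarrow> x \<noteq> 0 \<and> y \<noteq> 0 \<and> (\<exists>c. c \<noteq> 0 \<and> x = c *s y)"

text \<open>Points and lines are both elements of this type. The value \<open>proj_class x\<close> is the class of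
  \<open>x\<close>; it is meaningful only for \<open>x \<noteq> 0\<close>.\<close>

quotient_type (overloaded) 'a proj2 = "('a::field) ^ 3" / partial: proj_rel
  morphisms rep_proj2 proj_class
proof (rule part_equivpI)
  have "proj_rel (1 :: 'a ^ 3) 1"
    unfolding proj_rel_def by (auto intro!: exI[of _ 1])
  then show "\<exists>x :: 'a ^ 3. proj_rel x x" ..
  show "symp (proj_rel :: 'a ^ 3 \<Rightarrow> _)"
  proof (rule sympI)
    fix x y :: "'a ^ 3" assume "proj_rel x y"
    then obtain c where c: "x \<noteq> 0" "y \<noteq> 0" "c \<noteq> 0" "x = c *s y" by (auto simp: proj_rel_def)
    then have "y = inverse c *s x" by (simp add: vector_smult_assoc)
    with c show "proj_rel y x" unfolding proj_rel_def
      by (metis nonzero_imp_inverse_nonzero)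
  qed
  show "transp (proj_rel :: 'a ^ 3 \<Rightarrow> _)"
  proof (rule transpI)
    fix x y z :: "'a ^ 3" assume "proj_rel x y" "proj_rel y z"
    then obtain c d where "x \<noteq> 0" "z \<noteq> 0" "c \<noteq> 0" "d \<noteq> 0" "x = (c * d) *s z"
      by (auto simp: proj_rel_def vector_smult_assoc)
    then show "proj_rel x z" unfolding proj_rel_def by (metis no_zero_divisors)
  qed
qed

lemma proj_class_eq_iff:
  "x \<noteq> 0 \<Longrightarrow> y \<noteq> 0 \<Longrightarrow> proj_class x = proj_class y \<longleftrightarrow> (\<exists>c. c \<noteq> 0 \<and> x = c *s y)"
proof -
  assume xy: "x \<noteq> 0" "y \<noteq> 0"
  have refl: "proj_rel z z" if "z \<noteq> 0" for z :: "'a ^ 3"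
    using that unfolding proj_rel_def by (auto intro!: exI[of _ 1])
  show ?thesis
    using Quotient3_rel[OF Quotient3_proj2, of x y] refl[OF xy(1)] refl[OF xy(2)] xy
    by (auto simp: proj_rel_def)
qed

text \<open>Appreciable representatives are not unique, so \<open>app_reps\<close> and \<open>app_mats\<close> collect all of them.
  The notions below ask for some representative; the truth value is the same for every
  representative, see \<open>almost_equivalent_iff\<close> and \<open>almost_collinear_iff\<close>. The hyperreal norms are
  embedded by \<open>of_hreal\<close>, so that the factors \<open>l\<close> range over the ground field.\<close>

definition app_reps :: "'a::real_normed_field hyper proj2 \<Rightarrow> ('a hyper ^ 3) set" where
  "app_reps p = {inverse l *s x | l x.
     x \<noteq> 0 \<and> proj_class x = p \<and> l \<in> mag (of_hreal (hvec_norm x))}"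

definition app_mats :: "'a::real_normed_field hyper ^ 3 ^ 3 \<Rightarrow> ('a hyper ^ 3 ^ 3) set" where
  "app_mats M = {(\<chi> i j. inverse l * M $ i $ j) | l. l \<in> mag (of_hreal (frobenius_norm M))}"

definition almost_singular :: "'a::real_normed_field hyper ^ 3 ^ 3 \<Rightarrow> bool" where
  "almost_singular M \<longleftrightarrow> M \<noteq> 0 \<and>
     (\<exists>N\<in>app_mats M. infinitesimal (det N) \<and> det N \<noteq> 0)"

text \<open>For invertible \<open>M\<close> the class of \<open>N *v v\<close> does not depend on the representatives chosen,
  see \<open>proj_transform_class\<close> below.\<close>

definition proj_transform ::
  "'a::real_normed_field hyper ^ 3 ^ 3 \<Rightarrow> 'a hyper proj2 \<Rightarrow> 'a hyper proj2" where
  "proj_transform M p =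
     proj_class (SOME w. \<exists>N\<in>app_mats M. \<exists>v\<in>app_reps p. w = N *v v)"

definition almost_equivalent ::
  "'a::real_normed_field hyper proj2 \<Rightarrow> 'a hyper proj2 \<Rightarrow> bool" where
  "almost_equivalent x y \<longleftrightarrow>
     (\<exists>u\<in>app_reps x. \<exists>v\<in>app_reps y. \<exists>l. u \<simeq> l *s v)"

text \<open>The line through \<open>y\<close> and \<open>z\<close> exists only if \<open>y \<noteq> z\<close> (otherwise the cross product
  vanishes), so joining is a relation rather than a total function. In particular,
  \<open>almost_collinear x y z\<close> entails \<open>y \<noteq> z\<close>.\<close>

definition is_join ::
  "'a::real_normed_field hyper proj2 \<Rightarrow> 'a hyper proj2 \<Rightarrow> 'a hyper proj2 \<Rightarrow> bool" where
  "is_join y z l \<longleftrightarrow>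
     (\<exists>u\<in>app_reps y. \<exists>v\<in>app_reps z. cross u v \<noteq> 0 \<and> l = proj_class (cross u v))"

definition almost_collinear ::
  "'a::{real_normed_field, conjugatable_field} hyper proj2 \<Rightarrow> 'a hyper proj2 \<Rightarrow>
     'a hyper proj2 \<Rightarrow> bool" where
  "almost_collinear x y z \<longleftrightarrow>
     (\<exists>l. is_join y z l \<and> (\<exists>u\<in>app_reps x. \<exists>v\<in>app_reps l. infinitesimal (hinner u v)))"

section \<open>Independence of the chosen representatives\<close>

lemma hnorm_mult: "hnorm (a * b) = hnorm a * hnorm b"
  by transfer (simp add: hyper_rel_def norm_mult)

lemma hnorm_zero [simp]: "hnorm 0 = 0"
  by transfer (simp add: hyper_rel_def)

lemma hnorm_one [simp]: "hnorm 1 = 1"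
  by transfer (simp add: hyper_rel_def)

lemma hnorm_eq_0_iff [simp]: "hnorm a = 0 \<longleftrightarrow> a = 0"
  by transfer (simp add: hyper_rel_def)

lemma hnorm_nonneg [simp]: "0 \<le> hnorm a"
  by transfer simp

lemma hnorm_inverse: "hnorm (inverse a) = inverse (hnorm a)"
  by transfer (simp add: hyper_rel_def norm_inverse)

lemma hnorm_of_hreal: "hnorm (of_hreal x) = \<bar>x\<bar>"
  by transfer (simp add: hyper_rel_def)

lemma of_hreal_eq_0_iff [simp]: "of_hreal x = 0 \<longleftrightarrow> x = 0"
  by transfer (simp add: hyper_rel_def)

lemma hconj_mult: "hconj (a * b) = hconj a * hconj b"
  by transfer (simp add: hyper_rel_def conjugate_dist_mul)

lemma hsqrt_pos: "0 < x \<Longrightarrow> 0 < hsqrt x"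
  by transfer (auto elim: eventually_mono)

lemma hsqrt_nonneg: "0 \<le> x \<Longrightarrow> 0 \<le> hsqrt x"
  by transfer (auto elim: eventually_mono)

lemma hsqrt_mult: "hsqrt (x * y) = hsqrt x * hsqrt y"
  by transfer (simp add: hyper_rel_def real_sqrt_mult)

lemma hsqrt_square: "hsqrt (x\<^sup>2) = \<bar>x\<bar>"
  unfolding power2_eq_square by transfer (simp add: hyper_rel_def)

lemma hvec_norm_nonneg: "0 \<le> hvec_norm v"
  unfolding hvec_norm_def by (intro hsqrt_nonneg sum_nonneg) simp

lemma hvec_norm_pos: "v \<noteq> 0 \<Longrightarrow> 0 < hvec_norm v"
proof -
  assume "v \<noteq> 0"
  then obtain i where i: "v $ i \<noteq> 0" by (auto simp: vec_eq_iff)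
  have "0 < (hnorm (v $ i))\<^sup>2" using i by simp
  also have "\<dots> \<le> (\<Sum>i\<in>UNIV. (hnorm (v $ i))\<^sup>2)"
    by (rule member_le_sum) auto
  finally show ?thesis unfolding hvec_norm_def by (rule hsqrt_pos)
qed

lemma hvec_norm_smult: "hvec_norm (c *s v) = hnorm c * hvec_norm v"
  by (simp add: hvec_norm_def hnorm_mult power_mult_distrib sum_distrib_left[symmetric]
      hsqrt_mult hsqrt_square)

lemma appreciable_iff_hnorm: "appreciable a \<longleftrightarrow> appreciable (hnorm a)"
  by (simp add: appreciable_def hnorm_real)

lemma appreciable_one: "appreciable 1"
  unfolding appreciable_def by (intro exI[of _ 2]) simp

lemma appreciable_nonzero: "appreciable a \<Longrightarrow> a \<noteq> 0"
  by (auto simp: appreciable_def)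

lemma appreciable_mult:
  assumes "appreciable a" "appreciable b"
  shows "appreciable (a * b)"
proof -
  obtain m n :: nat where m: "1 / of_nat m < hnorm a" "hnorm a < of_nat m"
    and n: "1 / of_nat n < hnorm b" "hnorm b < of_nat n"
    using assms by (auto simp: appreciable_def)
  have "1 / of_nat (m * n) < hnorm (a * b)"
    using mult_strict_mono'[OF m(1) n(1)] by (simp add: hnorm_mult)
  moreover have "hnorm (a * b) < of_nat (m * n)"
    using mult_strict_mono'[OF m(2) n(2)] by (simp add: hnorm_mult)
  ultimately show ?thesis unfolding appreciable_def by blast
qed

lemma appreciable_inverse:
  assumes "appreciable a"
  shows "appreciable (inverse a)"
proof -
  obtain n :: nat where n: "1 / of_nat n < hnorm a" "hnorm a < of_nat n"
    using assms by (auto simp: appreciable_def)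
  have pos: "0 < hnorm a" by (rule order_le_less_trans[OF _ n(1)]) simp
  then have "0 < (of_nat n :: real hyper)" using n(2) by (rule less_trans)
  with n pos have "1 / of_nat n < inverse (hnorm a)" "inverse (hnorm a) < of_nat n"
    by (simp_all add: field_simps)
  then have "1 / of_nat n < hnorm (inverse a)" "hnorm (inverse a) < of_nat n"
    by (simp_all only: hnorm_inverse)
  then show ?thesis unfolding appreciable_def by blast
qed

lemma infinitesimal_mult_appreciable:
  assumes "appreciable a" "infinitesimal e"
  shows "infinitesimal (a * e)"
  unfolding infinitesimal_def
proof (intro allI impI)
  fix k :: nat assume k: "k > 0"
  obtain n :: nat where n: "hnorm a < of_nat n"
    using assms by (auto simp: appreciable_def)
  have npos: "0 < (of_nat n :: real hyper)" using n by (rule order_le_less_trans[rotated]) simp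
  then have "n * k > 0" using k by simp
  then have e: "hnorm e < 1 / of_nat (n * k)"
    using assms(2) unfolding infinitesimal_def by blast
  have "hnorm (a * e) \<le> of_nat n * hnorm e"
    unfolding hnorm_mult using n by (intro mult_right_mono) auto
  also have "\<dots> < of_nat n * (1 / of_nat (n * k))"
    using e npos by (rule mult_strict_left_mono)
  also have "\<dots> = 1 / of_nat k" using npos by simp
  finally show "hnorm (a * e) < 1 / of_nat k" .
qed

lemma infinitesimal_mult_appreciable_iff:
  assumes "appreciable a"
  shows "infinitesimal (a * e) \<longleftrightarrow> infinitesimal e"
  using infinitesimal_mult_appreciable[OF assms, of e]
    infinitesimal_mult_appreciable[OF appreciable_inverse[OF assms], of "a * e"]
    appreciable_nonzero[OF assms]
  by (auto simp: mult.assoc[symmetric])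

lemma proj_class_cases:
  obtains x where "x \<noteq> 0" "p = proj_class x"
proof
  have "proj_rel (rep_proj2 p) (rep_proj2 p)"
    by (rule Quotient3_rep_reflp[OF Quotient3_proj2])
  then show "rep_proj2 p \<noteq> 0" by (simp add: proj_rel_def)
  show "p = proj_class (rep_proj2 p)"
    by (simp add: Quotient3_abs_rep[OF Quotient3_proj2])
qed

lemma app_reps_iff:
  "v \<in> app_reps p \<longleftrightarrow> v \<noteq> 0 \<and> proj_class v = p \<and> appreciable (hvec_norm v)"
proof
  assume "v \<in> app_reps p"
  then obtain l x A where v: "v = inverse l *s x" and x: "x \<noteq> 0" "proj_class x = p"
    and l: "l \<noteq> 0" and A: "appreciable A" "of_hreal (hvec_norm x) = A * l"
    by (auto simp: app_reps_def mag_def)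
  have v0: "v \<noteq> 0" using v x l by simp
  have "x = l *s v" using v l by (simp add: vector_smult_assoc)
  then have "proj_class v = p"
    using proj_class_eq_iff[OF x(1) v0] x(2) l by auto
  moreover have "hvec_norm v = hnorm A"
  proof -
    have "hvec_norm x = hnorm A * hnorm l"
      using arg_cong[OF A(2), of hnorm] by (simp add: hnorm_of_hreal hnorm_mult hvec_norm_nonneg)
    then show ?thesis using l by (simp add: v hvec_norm_smult hnorm_inverse)
  qed
  ultimately show "v \<noteq> 0 \<and> proj_class v = p \<and> appreciable (hvec_norm v)"
    using v0 A(1) appreciable_iff_hnorm[of A] by simp
next
  assume v: "v \<noteq> 0 \<and> proj_class v = p \<and> appreciable (hvec_norm v)"
  have "appreciable (of_hreal (hvec_norm v) :: 'a hyper)"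
    using v appreciable_iff_hnorm[of "of_hreal (hvec_norm v) :: 'a hyper"]
    by (simp add: hnorm_of_hreal hvec_norm_nonneg)
  then have "1 \<in> mag (of_hreal (hvec_norm v) :: 'a hyper)" by (auto simp: mag_def)
  then show "v \<in> app_reps p"
    using v unfolding app_reps_def by (auto intro!: exI[of _ 1] exI[of _ v])
qed

lemma app_reps_nonempty: "app_reps p \<noteq> {}"
proof -
  obtain x where x: "x \<noteq> 0" "p = proj_class x" by (rule proj_class_cases)
  define l :: "'a hyper" where "l = of_hreal (hvec_norm x)"
  have "l \<in> mag l"
    using hvec_norm_pos[OF x(1)] appreciable_one by (auto simp: mag_def l_def intro!: exI[of _ 1])
  then show ?thesis using x unfolding app_reps_def l_def by blast
qed

lemma app_reps_scale:
  assumes "u \<in> app_reps p" "v \<in> app_reps p"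
  obtains c where "appreciable c" "u = c *s v"
proof -
  have uv: "u \<noteq> 0" "v \<noteq> 0" "proj_class u = proj_class v"
    "appreciable (hvec_norm u)" "appreciable (hvec_norm v)"
    using assms by (auto simp: app_reps_iff)
  then obtain c where c: "u = c *s v" by (auto simp: proj_class_eq_iff)
  have "hnorm c = hvec_norm u * inverse (hvec_norm v)"
    using hvec_norm_pos[OF uv(2)] by (simp add: c hvec_norm_smult mult.assoc)
  then have "appreciable c"
    using uv appreciable_iff_hnorm[of c] by (simp add: appreciable_mult appreciable_inverse)
  with c show ?thesis by (rule that[rotated])
qed

lemma app_mats_nonempty:
  assumes "M \<noteq> 0"
  shows "app_mats M \<noteq> {}"
proof -
  obtain i j where ij: "M $ i $ j \<noteq> 0" using assms by (auto simp: vec_eq_iff)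
  have "0 < (hnorm (M $ i $ j))\<^sup>2" using ij by simp
  also have "\<dots> \<le> (\<Sum>j\<in>UNIV. (hnorm (M $ i $ j))\<^sup>2)"
    by (rule member_le_sum) auto
  also have "\<dots> \<le> (\<Sum>i\<in>UNIV. \<Sum>j\<in>UNIV. (hnorm (M $ i $ j))\<^sup>2)"
    by (rule member_le_sum[where f = "\<lambda>i. \<Sum>j\<in>UNIV. (hnorm (M $ i $ j))\<^sup>2"]) (auto intro: sum_nonneg)
  finally have "0 < frobenius_norm M" unfolding frobenius_norm_def by (rule hsqrt_pos)
  then have "of_hreal (frobenius_norm M) \<in> mag (of_hreal (frobenius_norm M) :: 'a hyper)"
    using appreciable_one by (auto simp: mag_def intro!: exI[of _ 1])
  then show ?thesis unfolding app_mats_def by blast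
qed

lemma proj_transform_class:
  assumes "invertible M" "x \<noteq> 0"
  shows "M *v x \<noteq> 0" "proj_transform M (proj_class x) = proj_class (M *v x)"
proof -
  obtain M' where M': "M' ** M = mat 1" using assms(1) by (auto simp: invertible_def)
  show Mx: "M *v x \<noteq> 0"
  proof
    assume "M *v x = 0"
    then have "(M' ** M) *v x = 0" by (simp add: matrix_vector_mul_assoc[symmetric])
    then show False using M' assms(2) by simp
  qed
  then have "M \<noteq> 0" by auto
  then have "\<exists>w. \<exists>N\<in>app_mats M. \<exists>v\<in>app_reps (proj_class x). w = N *v v"
    using app_mats_nonempty[of M] app_reps_nonempty[of "proj_class x"] by blast
  then obtain N v where N: "N \<in> app_mats M" and v: "v \<in> app_reps (proj_class x)"
    and w: "(SOME w. \<exists>N\<in>app_mats M. \<exists>v\<in>app_reps (proj_class x). w = N *v v) = N *v v"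
    using someI_ex[of "\<lambda>w. \<exists>N\<in>app_mats M. \<exists>v\<in>app_reps (proj_class x). w = N *v v"]
    by blast
  obtain l where l: "l \<noteq> 0" "N = (\<chi> i j. inverse l * M $ i $ j)"
    using N by (auto simp: app_mats_def mag_def)
  obtain c where c: "c \<noteq> 0" "v = c *s x"
    using v assms(2) by (auto simp: app_reps_iff proj_class_eq_iff)
  have eq: "N *v v = (inverse l * c) *s (M *v x)"
    by (simp add: vec_eq_iff l(2) c(2) matrix_vector_mult_def sum_distrib_left mult_ac)
  have "inverse l * c \<noteq> 0" using l c by simp
  moreover from this have "N *v v \<noteq> 0" unfolding eq using Mx by simp
  ultimately have "proj_class (N *v v) = proj_class (M *v x)"
    using Mx eq proj_class_eq_iff by blast
  then show "proj_transform M (proj_class x) = proj_class (M *v x)"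
    unfolding proj_transform_def w .
qed

lemma almost_equivalent_iff:
  assumes "u \<in> app_reps x" "v \<in> app_reps y"
  shows "almost_equivalent x y \<longleftrightarrow> (\<exists>l. u \<simeq> l *s v)"
proof
  assume "almost_equivalent x y"
  then obtain u' v' l where u': "u' \<in> app_reps x" and v': "v' \<in> app_reps y"
    and close: "u' \<simeq> l *s v'"
    by (auto simp: almost_equivalent_def)
  obtain c where c: "appreciable c" "u = c *s u'" using app_reps_scale[OF assms(1) u'] .
  obtain d where d: "appreciable d" "v' = d *s v" using app_reps_scale[OF v' assms(2)] .
  have "infinitesimal (c * (u' $ i - (l *s v') $ i))" for i
    using close c(1) by (simp add: inf_close_def infinitesimal_mult_appreciable)
  then have "u \<simeq> (c * l * d) *s v"
    by (simp add: inf_close_def c(2) d(2) algebra_simps)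
  then show "\<exists>l. u \<simeq> l *s v" ..
qed (use assms in \<open>auto simp: almost_equivalent_def\<close>)

lemma cross_smult: "cross (a *s u) (b *s v) = (a * b) *s cross u v"
  by (simp add: cross_def vec_eq_iff forall_3 algebra_simps)

lemma hinner_smult: "hinner (a *s u) (b *s v) = (hconj a * b) * hinner u v"
  by (simp add: hinner_def hconj_mult sum_distrib_left mult_ac)

lemma appreciable_hconj:
  fixes a :: "'a::{real_normed_field, conjugatable_field} hyper"
  assumes "\<And>z :: 'a. norm (conjugate z) = norm z"
  shows "appreciable (hconj a) \<longleftrightarrow> appreciable a"
proof -
  have "hnorm (hconj a) = hnorm a" using assms by transfer (simp add: hyper_rel_def)
  then show ?thesis by (simp add: appreciable_def)
qed

text \<open>The assumption on the conjugation holds for both ground fields.\<close>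

lemma almost_collinear_iff:
  fixes x :: "'a::{real_normed_field, conjugatable_field} hyper proj2"
  assumes conj: "\<And>z :: 'a. norm (conjugate z) = norm z"
    and t: "t \<in> app_reps x" and u: "u \<in> app_reps y" and v: "v \<in> app_reps z"
    and nz: "cross u v \<noteq> 0" and w: "w \<in> app_reps (proj_class (cross u v))"
  shows "almost_collinear x y z \<longleftrightarrow> infinitesimal (hinner t w)"
proof
  assume "almost_collinear x y z"
  then obtain u' v' t' w' where
    u': "u' \<in> app_reps y" and v': "v' \<in> app_reps z" and t': "t' \<in> app_reps x"
    and nz': "cross u' v' \<noteq> 0" and w': "w' \<in> app_reps (proj_class (cross u' v'))"
    and inf: "infinitesimal (hinner t' w')"
    by (auto simp: almost_collinear_def is_join_def)
  obtain a where a: "appreciable a" "u = a *s u'" using app_reps_scale[OF u u'] .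
  obtain b where b: "appreciable b" "v = b *s v'" using app_reps_scale[OF v v'] .
  have "proj_class (cross u v) = proj_class (cross u' v')"
    using proj_class_eq_iff[OF nz nz'] a b appreciable_nonzero[OF appreciable_mult[OF a(1) b(1)]]
    by (auto simp: cross_smult)
  then obtain c where c: "appreciable c" "w = c *s w'" using app_reps_scale[of w _ w'] w w' by metis
  obtain d where d: "appreciable d" "t = d *s t'" using app_reps_scale[OF t t'] .
  have "appreciable (hconj d * c)"
    using c d appreciable_hconj[OF conj] by (simp add: appreciable_mult)
  then show "infinitesimal (hinner t w)"
    using inf by (simp add: c(2) d(2) hinner_smult infinitesimal_mult_appreciable)
qed (use assms in \<open>auto simp: almost_collinear_def is_join_def\<close>)

end

theory Submission
  imports Defs
begin

text \<open>For a nonzero infinitesimal \<open>e\<close> the matrix \<open>M = diag (1, 1, e)\<close> has appreciable norm and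
  determinant \<open>e\<close>, so it is almost singular. In the affine chart it acts near the point
  \<open>[0 : 0 : 1]\<close>, which it fixes, as a magnification by \<open>1 / e\<close>: a point at infinitesimal distance
  can be moved to an appreciable distance. Concretely, the point \<open>[0 : e : 1]\<close>, which is almost
  equivalent to \<open>[0 : 0 : 1]\<close>, is sent to \<open>[0 : e : e] = [0 : 1 : 1]\<close>, which is not.

  The same pair of points refutes the preservation of almost collinearity. The line that joins
  \<open>[1 : 0 : 0]\<close> and \<open>[0 : e : 1]\<close> is \<open>(0, -1, e)\<close>, and its product with \<open>(0, 0, 1)\<close> is \<open>e\<close>; so
  \<open>[0 : 0 : 1]\<close> almost lies on it. The image line joins \<open>[1 : 0 : 0]\<close> and \<open>[0 : 1 : 1]\<close>; it is
  \<open>(0, -1, 1)\<close>, whose product with the fixed point \<open>(0, 0, 1)\<close> is \<open>1\<close>.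

  The vectors used for these points and lines have entries of absolute value at most \<open>1\<close>, one of
  which is \<open>\<plusminus>1\<close> (after the factor \<open>e\<close> is removed from \<open>(0, e, e)\<close>). Hence they are their own
  appreciable representatives (\<open>app_repsI\<close>), and the independence of the chosen representatives
  reduces every claim to a computation with these vectors. The computation is
  the same for both ground fields.\<close>

lemma not_infinitesimal_one: "\<not> infinitesimal 1"
  unfolding infinitesimal_def by (auto intro!: exI[of _ 1])

lemma infinitesimal_zero: "infinitesimal 0"
  by (simp add: infinitesimal_def)

lemma infinitesimal_hnorm_le_one: "infinitesimal e \<Longrightarrow> hnorm e \<le> 1"
  unfolding infinitesimal_def by (drule spec[of _ 1]) simp

text \<open>The witness is the class of the null sequence \<open>1 / (n + 1)\<close>. It lies below every
  \<open>1 / k\<close> because the ultrafilter contains all cofinite sets.\<close>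

lemma nonzero_infinitesimal_exists:
  "\<exists>e :: 'a::real_normed_field hyper. e \<noteq> 0 \<and> infinitesimal e"
proof (intro exI conjI)
  let ?e = "class_of (\<lambda>n. inverse (of_nat (Suc n))) :: 'a hyper"
  have "\<not> hyper_rel (\<lambda>n. inverse (of_nat (Suc n)) :: 'a) (\<lambda>n. 0)"
    by (simp add: hyper_rel_def U_nontrivial del: of_nat_Suc)
  then show "?e \<noteq> 0"
    by (simp add: zero_hyper.abs_eq hyper.abs_eq_iff)
  have "hnorm ?e < hyper_const (1 / of_nat k)" if "k > 0" for k :: nat
  proof -
    have "eventually (\<lambda>n. norm (inverse (of_nat (Suc n)) :: 'a) < 1 / of_nat k) sequentially"
      using eventually_gt_at_top[of k]
    proof eventually_elim
      case (elim n)
      have "norm (inverse (of_nat (Suc n)) :: 'a) = 1 / of_nat (Suc n)"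
        by (simp only: norm_inverse norm_of_nat divide_inverse mult_1)
      also have "\<dots> < 1 / of_nat k"
        using elim that by (simp add: frac_less2)
      finally show ?case .
    qed
    then show ?thesis
      unfolding hnorm.abs_eq hyper_const.abs_eq less_hyper.abs_eq
      by (rule filter_leD[OF U_le_sequentially])
  qed
  moreover have of_nat: "(of_nat k :: real hyper) = hyper_const (of_nat k)" for k
  proof (induction k)
    case 0
    have "0 = (hyper_const 0 :: real hyper)" by transfer (simp add: hyper_rel_def)
    then show ?case by simp
  next
    case (Suc k)
    have "hyper_const (of_nat (Suc k)) = 1 + (hyper_const (of_nat k) :: real hyper)"
      by transfer (simp add: hyper_rel_def)
    with Suc show ?case by simp
  qed
  moreover have "hyper_const (1 / of_nat k) = 1 / (hyper_const (of_nat k) :: real hyper)" for k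
    by transfer (simp add: hyper_rel_def)
  ultimately show "infinitesimal ?e"
    by (simp add: infinitesimal_def)
qed

text \<open>The range of \<open>s\<close> is that of the sum of three squares, each at most \<open>1\<close> and one equal
  to \<open>1\<close>.\<close>

lemma appreciable_hsqrt:
  assumes "1 \<le> s" "s \<le> 3"
  shows "appreciable (hsqrt s)"
proof -
  have "1 \<le> hsqrt s" using assms(1)
    by transfer (auto elim: eventually_mono)
  moreover have "hsqrt s \<le> hsqrt (2\<^sup>2)"
  proof -
    have mono: "hsqrt a \<le> hsqrt b" if "a \<le> b" for a b
      using that by transfer (auto elim: eventually_mono)
    show ?thesis using assms(2) by (intro mono) simp
  qed
  then have "hsqrt s \<le> 2" unfolding hsqrt_square by simp
  ultimately show ?thesis
    unfolding appreciable_def by (intro exI[of _ 3]) (simp add: hnorm_real)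
qed

lemma app_repsI:
  assumes le: "\<And>i. hnorm (v $ i) \<le> 1" and eq: "hnorm (v $ k) = 1"
  shows "v \<in> app_reps (proj_class v)"
proof -
  have sq: "(hnorm (v $ i))\<^sup>2 \<le> 1" for i
    using le by (simp add: power_le_one)
  have "(hnorm (v $ k))\<^sup>2 \<le> (\<Sum>i\<in>UNIV. (hnorm (v $ i))\<^sup>2)"
    by (rule member_le_sum) auto
  then have "appreciable (hvec_norm v)"
    unfolding hvec_norm_def eq using sq[of 1] sq[of 2] sq[of 3]
    by (intro appreciable_hsqrt) (simp_all add: sum_3)
  moreover have "v \<noteq> 0" using eq by auto
  ultimately show ?thesis by (simp add: app_reps_iff)
qed

text \<open>These points form the second coordinate axis of the affine chart around \<open>[0 : 0 : 1]\<close>; the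
  whole argument takes place on it and in the direction \<open>[1 : 0 : 0]\<close> of the first axis.\<close>

definition near_point :: "'a::field \<Rightarrow> 'a ^ 3" where
  "near_point t = vector [0, t, 1]"

definition squeeze :: "'a::field \<Rightarrow> 'a ^ 3 ^ 3" where
  "squeeze e = vector [vector [1, 0, 0], vector [0, 1, 0], vector [0, 0, e]]"

lemma hnorm_minus: "hnorm (- a) = hnorm a"
  by transfer (simp add: hyper_rel_def)

lemma det_squeeze: "det (squeeze e) = e"
  by (simp add: squeeze_def det_3)

lemma invertible_squeeze: "e \<noteq> 0 \<Longrightarrow> invertible (squeeze e)"
  by (simp add: invertible_det_nz det_squeeze)

lemma almost_singular_squeeze:
  fixes e :: "'a::real_normed_field hyper"
  assumes "e \<noteq> 0" "infinitesimal e"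
  shows "almost_singular (squeeze e)"
proof -
  have "(hnorm e)\<^sup>2 \<le> 1"
    using infinitesimal_hnorm_le_one[OF assms(2)] by (simp add: power_le_one)
  then have "appreciable (frobenius_norm (squeeze e))"
    unfolding frobenius_norm_def
    by (intro appreciable_hsqrt) (simp_all add: sum_3 squeeze_def)
  then have "appreciable (of_hreal (frobenius_norm (squeeze e)) :: 'a hyper)"
    by (simp add: appreciable_def hnorm_of_hreal hnorm_real)
  then have "1 \<in> mag (of_hreal (frobenius_norm (squeeze e)) :: 'a hyper)"
    by (auto simp: mag_def)
  then have "squeeze e \<in> app_mats (squeeze e)"
    unfolding app_mats_def by (auto intro!: exI[of _ 1])
  moreover have "squeeze e \<noteq> 0"
    using assms(1) by (auto simp: squeeze_def vec_eq_iff forall_3)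
  ultimately show ?thesis
    using assms unfolding almost_singular_def
    by (intro conjI bexI[of _ "squeeze e"]) (simp_all add: det_squeeze)
qed

lemma near_point_app_reps:
  "hnorm t \<le> 1 \<Longrightarrow> near_point t \<in> app_reps (proj_class (near_point t))"
proof (rule app_repsI[of _ 3])
  fix i :: 3
  assume "hnorm t \<le> 1"
  then show "hnorm (near_point t $ i) \<le> 1"
    using exhaust_3[of i] by (auto simp: near_point_def)
qed (simp add: near_point_def)

text \<open>Scaling the third coordinate by \<open>e\<close> divides the affine coordinate by \<open>e\<close>.\<close>

lemma squeeze_near_point:
  fixes t :: "'a::real_normed_field hyper"
  assumes "e \<noteq> 0"
  shows "proj_transform (squeeze e) (proj_class (near_point (e * t))) = proj_class (near_point t)"
proof -
  have nz: "near_point s \<noteq> 0" for s :: "'a hyper"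
    by (auto simp: near_point_def vec_eq_iff forall_3)
  have eq: "squeeze e *v near_point (e * t) = e *s near_point t"
    by (simp add: vec_eq_iff forall_3 matrix_vector_mult_def sum_3 squeeze_def near_point_def)
  have "proj_class (e *s near_point t) = proj_class (near_point t)"
    using assms nz[of t] by (subst proj_class_eq_iff) auto
  then show ?thesis
    using proj_transform_class(2)[OF invertible_squeeze[OF assms] nz[of "e * t"]] eq by simp
qed

lemma squeeze_axis:
  fixes e :: "'a::real_normed_field hyper"
  assumes "e \<noteq> 0"
  shows "proj_transform (squeeze e) (proj_class (axis 1 1)) = proj_class (axis 1 1)"
proof -
  have "squeeze e *v axis 1 1 = axis 1 1"
    by (simp add: vec_eq_iff forall_3 matrix_vector_mult_def sum_3 squeeze_def axis_def)
  moreover have "(axis 1 1 :: 'a hyper ^ 3) \<noteq> 0"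
    by (simp add: axis_eq_0_iff)
  ultimately show ?thesis
    using proj_transform_class(2)[OF invertible_squeeze[OF assms]] by metis
qed

lemma near_point_almost_equivalent_iff:
  fixes t :: "'a::real_normed_field hyper"
  assumes "hnorm t \<le> 1"
  shows "almost_equivalent (proj_class (near_point t)) (proj_class (near_point 0))
    \<longleftrightarrow> infinitesimal t"
proof -
  have "(\<exists>l. near_point t \<simeq> l *s near_point 0) \<longleftrightarrow> infinitesimal t"
    by (auto simp: inf_close_def forall_3 near_point_def infinitesimal_zero intro!: exI[of _ 1])
  then show ?thesis
    using almost_equivalent_iff[OF near_point_app_reps[OF assms] near_point_app_reps[of 0]] by simp
qed

lemma hconj_one: "hconj 1 = 1"
proof -
  have "conjugate 1 = (1 :: 'a)"
    using conjugate_dist_mul[of "conjugate 1" "1 :: 'a"] by simp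
  then show ?thesis by transfer (simp add: hyper_rel_def)
qed

lemma hconj_zero: "hconj 0 = 0"
  by transfer (simp add: hyper_rel_def)

text \<open>The line through \<open>[1 : 0 : 0]\<close> and \<open>[0 : t : 1]\<close> meets the chart in the points with second
  coordinate \<open>t\<close>, so \<open>t\<close> measures the distance from \<open>[0 : 0 : 1]\<close> to this line.\<close>

lemma near_point_almost_collinear_iff:
  fixes t :: "'a::{real_normed_field, conjugatable_field} hyper"
  assumes conj: "\<And>z :: 'a. norm (conjugate z) = norm z" and t: "hnorm t \<le> 1"
  shows "almost_collinear (proj_class (near_point 0)) (proj_class (axis 1 1))
      (proj_class (near_point t)) \<longleftrightarrow> infinitesimal t"
proof -
  let ?l = "cross (axis 1 1) (near_point t)"
  have l: "?l = vector [0, -1, t]"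
    by (simp add: cross_def near_point_def axis_def)
  have nz: "?l \<noteq> 0"
    by (simp add: l vec_eq_iff forall_3)
  have "hnorm (?l $ i) \<le> 1" for i
    using t exhaust_3[of i] by (auto simp: l hnorm_minus)
  then have line: "?l \<in> app_reps (proj_class ?l)"
    by (rule app_repsI[of _ 2]) (simp add: l hnorm_minus)
  have ax: "axis 1 1 \<in> app_reps (proj_class (axis 1 1 :: 'a hyper ^ 3))"
    by (rule app_repsI[of _ 1]) (simp_all add: axis_def)
  have "hinner (near_point 0) ?l = t"
    unfolding l by (simp add: hinner_def sum_3 near_point_def hconj_one hconj_zero)
  then show ?thesis
    using almost_collinear_iff[OF conj near_point_app_reps[of 0] ax near_point_app_reps[OF t] nz line]
    by simp
qed

text \<open>The common argument for both ground fields; only the isometry of the conjugation is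
  specific to the field.\<close>

lemma almost_singular_transformation_not_preserving:
  assumes conj: "\<And>z :: 'a::{real_normed_field, conjugatable_field}. norm (conjugate z) = norm z"
  shows "\<exists>M :: 'a hyper ^ 3 ^ 3. invertible M \<and> almost_singular M \<and>
        (\<exists>p q. almost_equivalent p q \<and>
           \<not> almost_equivalent (proj_transform M p) (proj_transform M q)) \<and>
        (\<exists>x y z. almost_collinear x y z \<and>
           \<not> almost_collinear (proj_transform M x) (proj_transform M y) (proj_transform M z))"
proof -
  obtain e :: "'a hyper" where e: "e \<noteq> 0" "infinitesimal e"
    using nonzero_infinitesimal_exists by blast
  let ?o = "proj_class (near_point 0) :: 'a hyper proj2"
  let ?a = "proj_class (axis 1 1) :: 'a hyper proj2"
  let ?p = "proj_class (near_point e)"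
  let ?p' = "proj_class (near_point 1) :: 'a hyper proj2"
  let ?T = "proj_transform (squeeze e)"
  have T: "?T ?p = ?p'" "?T ?o = ?o" "?T ?a = ?a"
    using squeeze_near_point[OF e(1), of 1] squeeze_near_point[OF e(1), of 0] squeeze_axis[OF e(1)]
    by simp_all
  note small = infinitesimal_hnorm_le_one[OF e(2)]
  have "almost_equivalent ?p ?o" "\<not> almost_equivalent (?T ?p) (?T ?o)"
    using e(2) small by (simp_all add: T near_point_almost_equivalent_iff not_infinitesimal_one)
  moreover have "almost_collinear ?o ?a ?p" "\<not> almost_collinear (?T ?o) (?T ?a) (?T ?p)"
    using e(2) small
    by (simp_all add: T near_point_almost_collinear_iff[OF conj] not_infinitesimal_one)
  ultimately show ?thesis
    using invertible_squeeze[OF e(1)] almost_singular_squeeze[OF e] by blast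
qed

theorem lemma4p19:
  shows
    "(\<exists>M :: real hyper ^ 3 ^ 3. invertible M \<and> almost_singular M \<and>
        (\<exists>p q. almost_equivalent p q \<and>
           \<not> almost_equivalent (proj_transform M p) (proj_transform M q)) \<and>
        (\<exists>x y z. almost_collinear x y z \<and>
           \<not> almost_collinear (proj_transform M x) (proj_transform M y) (proj_transform M z))) \<and>
     (\<exists>M :: complex hyper ^ 3 ^ 3. invertible M \<and> almost_singular M \<and>
        (\<exists>p q. almost_equivalent p q \<and>
           \<not> almost_equivalent (proj_transform M p) (proj_transform M q)) \<and>
        (\<exists>x y z. almost_collinear x y z \<and>
           \<not> almost_collinear (proj_transform M x) (proj_transform M y) (proj_transform M z)))"
  by (intro conjI almost_singular_transformation_not_preserving) simp_all

end
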